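(* Let the nodes $w_i$, $i\in\mathcal{I}$, form one loop of the network graph and assume that no other loop in the graph contains any of these nodes. Suppose moreover that all the transfer functions involved in the loop are nonzero. Then measuring any one of these nodes is sufficient to identify all transfer functions in the loop.
   Context: Network. There are $L$ nodes with signals $w(t)=[w_1(t),\dots,w_L(t)]^T$ obeying $w(t)=G^0(q)w(t)+r(t)+v(t)$, where $q^{-1}$ is the delay operator, $r(t)$ is a vector of known external excitation signals (one at each node), $v(t)$ is a noise vector, and the network matrix $G^0$ is an $L\times L$ matrix with zero diagonal whose entries are proper rational transfer functions; the network is well-posed ($(I-G^0)^{-1}$ is proper and stable). $T^0=(I-G^0)^{-1}$. Topology. The topology is a known weakly connected directed graph on $\{1,\dots,L\}$ without self-loops; an edge $(j,i)$ from $j$ to $i$ corresponds to a transfer function $G_{ij}$ that is not known to be zero. A matrix $M$ is consistent with the graph if $M_{ij}\neq 0$ only if $(j,i)$ is an edge. $G^0$ is consistent with its graph. A walk is a sequence of adjacent directed edges; a loop is a walk whose terminal node coincides with its initial node; it is what is typically called a (directed) cycle in graph theory. The transfer functions in the loop are the $G^0_{ij}$ for the edges $(j,i)$ of the loop. Measurements and identifiability. $y(t)=Cw(t)$, where $C$ is a $p\times L$ matrix each row of which has one entry $1$ and all others $0$; the measured nodes are those selected by $C$. The matrix $CT^0$ is assumed exactly known. A transfer function $G^0_{ij}$ is identifiable from the measurements $C$ if $G_{ij}=G^0_{ij}$ for every transfer matrix $G$ consistent with the topology that satisfies $CT^0(I-G)=C$. *)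

theory Defs
  imports
    "HOL-Analysis.Analysis"
    "HOL-Computational_Algebra.Computational_Algebra"
    "HOL-Computational_Algebra.Field_as_Ring"
    "Graph_Theory.Graph_Theory"
begin

section \<open>Transfer functions\<close>

text \<open>
  Real rational functions in the forward shift \<open>q\<close>.  The function \<open>quot_of_fract\<close> returns the pair
  (numerator, denominator) in lowest terms, so the roots of the second component are exactly the
  poles; a transfer function is stable if they all lie in the open unit disc (discrete time).
\<close>

type_synonym transfer_fun = "real poly fract"

definition proper_tf :: "transfer_fun \<Rightarrow> bool" where
  "proper_tf f \<longleftrightarrow> degree (fst (quot_of_fract f)) \<le> degree (snd (quot_of_fract f))"

definition stable_tf :: "transfer_fun \<Rightarrow> bool" where
  "stable_tf f \<longleftrightarrow>
     (\<forall>z::complex. poly (map_poly complex_of_real (snd (quot_of_fract f))) z = 0 \<longrightarrow> cmod z < 1)"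

section \<open>Networks\<close>

text \<open>An arc \<open>(j, i)\<close> goes from \<open>j\<close> to \<open>i\<close> and corresponds to the matrix entry \<open>G $ i $ j\<close>.
  The constant \<open>connected\<close> of the digraph library is connectedness of the symmetric closure,
  that is, weak connectedness.\<close>

definition network_topology :: "'n::finite pair_pre_digraph \<Rightarrow> bool" where
  "network_topology N \<longleftrightarrow>
     pair_digraph N \<and> pverts N = UNIV \<and> Digraph_Component.connected (with_proj N)"

definition consistent :: "'n::finite pair_pre_digraph \<Rightarrow> transfer_fun^'n^'n \<Rightarrow> bool" where
  "consistent N G \<longleftrightarrow> (\<forall>i j. G $ i $ j \<noteq> 0 \<longrightarrow> (j, i) \<in> parcs N)"

definition network_matrix :: "transfer_fun^'n::finite^'n \<Rightarrow> bool" where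
  "network_matrix G \<longleftrightarrow> (\<forall>i. G $ i $ i = 0) \<and> (\<forall>i j. proper_tf (G $ i $ j))"

definition closed_loop :: "transfer_fun^'n::finite^'n \<Rightarrow> transfer_fun^'n^'n" where
  "closed_loop G = matrix_inv (mat 1 - G)"

definition well_posed :: "transfer_fun^'n::finite^'n \<Rightarrow> bool" where
  "well_posed G \<longleftrightarrow> invertible (mat 1 - G) \<and>
     (\<forall>i j. proper_tf (closed_loop G $ i $ j) \<and> stable_tf (closed_loop G $ i $ j))"

section \<open>Loops\<close>

text \<open>Loops are represented by lists of arcs (the library's \<open>cycle\<close>), with a distinguished starting
  node; lists that differ by a rotation describe the same loop.  Every node of a loop is the tail of
  exactly one of its arcs.\<close>

definition loop_nodes :: "('n \<times> 'n) list \<Rightarrow> 'n set" where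
  "loop_nodes p = fst ` set p"

definition same_loop :: "('n \<times> 'n) list \<Rightarrow> ('n \<times> 'n) list \<Rightarrow> bool" where
  "same_loop p p' \<longleftrightarrow> (\<exists>k. p' = rotate k p)"

section \<open>Measurements and identifiability\<close>

definition measurement_matrix :: "transfer_fun^'n::finite^'p::finite \<Rightarrow> bool" where
  "measurement_matrix C \<longleftrightarrow> (\<forall>k. \<exists>j. \<forall>i. C $ k $ i = (if i = j then 1 else 0))"

definition measured_nodes :: "transfer_fun^'n::finite^'p::finite \<Rightarrow> 'n set" where
  "measured_nodes C = {j. \<exists>k. C $ k $ j = 1}"

definition identifiable ::
  "'n::finite pair_pre_digraph \<Rightarrow> transfer_fun^'n^'n \<Rightarrow> transfer_fun^'n^'p::finite \<Rightarrow> 'n \<Rightarrow> 'n \<Rightarrow> bool"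
  where
  "identifiable N G0 C i j \<longleftrightarrow>
     (\<forall>G. consistent N G \<and> C ** closed_loop G0 ** (mat 1 - G) = C \<longrightarrow> G $ i $ j = G0 $ i $ j)"

end

theory Submission
  imports Defs
begin

text \<open>
  Let \<open>t\<close> be the row of \<open>T\<^sup>0\<close> that belongs to a measured node \<open>c\<close> of the loop.  Every admissible \<open>G\<close>
  satisfies \<open>t (I - G) = e\<^sub>c\<close>.  The entry \<open>t\<^sub>i\<close> vanishes unless \<open>i\<close> reaches \<open>c\<close>, and an arc from a loop
  node \<open>j\<close> to a node that reaches \<open>c\<close> closes a loop through \<open>j\<close>, hence belongs to the given loop.  So
  column \<open>j\<close> of the equation only involves the successor \<open>s\<close> of \<open>j\<close> on the loop:
  \<open>t\<^sub>j = \<delta>\<^sub>c\<^sub>j + t\<^sub>s G\<^sub>s\<^sub>j\<close>.  For \<open>G = G\<^sup>0\<close>, following the loop shows that \<open>t\<close> vanishes nowhere on it,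
  so that \<open>G\<^sub>s\<^sub>j\<close> is determined.
\<close>

lemma matrix_inv_mult_left:
  fixes A :: "'a::semiring_1^'n^'m"
  assumes "invertible A"
  shows "matrix_inv A ** A = mat 1"
  using assms unfolding invertible_def matrix_inv_def
  by (rule someI2_ex) blast

text \<open>The vectors supported on \<open>S\<close> form a finite-dimensional space that an injective map with this
  zero pattern maps onto itself.\<close>

lemma matrix_inv_zero_block:
  fixes A :: "'a::field^'n^'n"
  assumes inv: "invertible A"
    and block: "\<And>i j. i \<notin> S \<Longrightarrow> j \<in> S \<Longrightarrow> A $ i $ j = 0"
    and "i \<notin> S" "j \<in> S"
  shows "matrix_inv A $ i $ j = 0"
proof -
  define V where "V = {x::'a^'n. \<forall>i. i \<notin> S \<longrightarrow> x $ i = 0}"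
  have left_inv: "matrix_inv A *v (A *v x) = x" for x
    by (simp add: matrix_vector_mul_assoc matrix_inv_mult_left[OF inv])
  have "inj ((*v) A)"
    by (metis injI left_inv)
  have V: "vec.subspace V"
    unfolding V_def by (auto intro!: vec.subspaceI)
  have "(*v) A ` V \<subseteq> V"
  proof (clarsimp simp: V_def)
    fix x :: "'a^'n" and k
    assume "\<forall>i. i \<notin> S \<longrightarrow> x $ i = 0" "k \<notin> S"
    then have "A $ k $ l * x $ l = 0" for l
      using block by (cases "l \<in> S") auto
    then show "(A *v x) $ k = 0"
      by (simp add: matrix_vector_mult_def sum.neutral del: mult_eq_0_iff)
  qed
  moreover have "vec.dim ((*v) A ` V) = vec.dim V"
    using \<open>inj ((*v) A)\<close>
    by (intro vec.dim_image_eq) (auto intro: inj_on_subset matrix_vector_mul_linear_gen)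
  ultimately have "(*v) A ` V = V"
    using V by (intro vec.subspace_dim_equal vec.linear_subspace_image matrix_vector_mul_linear_gen) auto
  \<comment> \<open>Column \<open>j\<close> of the inverse is the preimage of
    \<open>axis j 1\<close>, and surjectivity on \<open>V\<close> puts that preimage in
    \<open>V\<close>.\<close>
  moreover have "axis j 1 \<in> V"
    using \<open>j \<in> S\<close> by (auto simp: V_def axis_def)
  ultimately obtain x where "x \<in> V" "A *v x = axis j 1"
    by (metis imageE)
  then have "matrix_inv A *v axis j 1 = x"
    using left_inv by metis
  then have "matrix_inv A $ i $ j = x $ i"
    by (auto simp: matrix_vector_mult_def axis_def if_distrib[of "\<lambda>y. _ * y"] cong: if_cong)
  with \<open>x \<in> V\<close> \<open>i \<notin> S\<close> show ?thesis
    by (simp add: V_def)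
qed

text \<open>An arc from a node that does not reach \<open>c\<close> can only lead to another such
  node. This gives \<open>mat 1 - G\<close> a zero block, which its inverse inherits;
  \<open>c\<close> itself lies outside the set.\<close>

lemma closed_loop_eq_0_if_unreachable:
  fixes G :: "transfer_fun^'n::finite^'n"
  assumes "invertible (mat 1 - G)" "consistent N G" "(i, c) \<notin> (parcs N)\<^sup>*"
  shows "closed_loop G $ c $ i = 0"
  unfolding closed_loop_def
proof (rule matrix_inv_zero_block[where S = "{i. (i, c) \<notin> (parcs N)\<^sup>*}"])
  fix k l assume kl: "k \<notin> {i. (i, c) \<notin> (parcs N)\<^sup>*}" "l \<in> {i. (i, c) \<notin> (parcs N)\<^sup>*}"
  then have "(l, k) \<notin> parcs N"
    by (auto intro: converse_rtrancl_into_rtrancl)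
  moreover have "k \<noteq> l"
    using kl by auto
  ultimately show "(mat 1 - G) $ k $ l = 0"
    using assms(2) by (auto simp: consistent_def mat_def)
qed (use assms in auto)

lemma pcas_rtrancl:
  assumes "pcas u p v" "e \<in> set p"
  shows "(u, fst e) \<in> (set p)\<^sup>*" "(fst e, v) \<in> (set p)\<^sup>*"
proof -
  \<comment> \<open>The conjunct for \<open>(u, v)\<close> covers the first arc of the walk, whose
    tail is \<open>u\<close>.\<close>
  have "(u, v) \<in> (set p)\<^sup>* \<and> (\<forall>e\<in>set p. (u, fst e) \<in> (set p)\<^sup>* \<and> (fst e, v) \<in> (set p)\<^sup>*)"
    using assms(1)
  proof (induction u p v rule: pcas.induct)
    case (2 u e es v)
    have "(set es)\<^sup>* \<subseteq> (set (e # es))\<^sup>*"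
      by (intro rtrancl_mono) auto
    with 2 have "(snd e, v) \<in> (set (e # es))\<^sup>*" and
      es: "\<forall>f\<in>set es. (snd e, fst f) \<in> (set (e # es))\<^sup>* \<and> (fst f, v) \<in> (set (e # es))\<^sup>*"
      by auto
    moreover have "(u, snd e) \<in> set (e # es)"
      using 2 by auto
    ultimately show ?case
      using 2 by (auto intro: converse_rtrancl_into_rtrancl)
  qed auto
  then show "(u, fst e) \<in> (set p)\<^sup>*" "(fst e, v) \<in> (set p)\<^sup>*"
    using assms(2) by auto
qed

context pair_wf_digraph
begin

text \<open>Connecting the nodes by arcs of \<open>p\<close> alone allows later inductions to stay
  on the loop.\<close>

lemma cycle_rtrancl:
  assumes "cycle p" "u \<in> loop_nodes p" "v \<in> loop_nodes p"
  shows "(u, v) \<in> (set p)\<^sup>*"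
proof -
  obtain w where "pcas w p w"
    using assms(1) by (auto simp: cycle_def awalk_def)
  with assms(2,3) show ?thesis
    by (auto simp: loop_nodes_def intro: rtrancl_trans[OF pcas_rtrancl(2) pcas_rtrancl(1)])
qed

text \<open>The node sequence of the walk is both its tails followed by the end node and the start
  node followed by its heads. In a closed walk the two extra nodes agree.\<close>

lemma cycle_heads:
  assumes "cycle p"
  shows "snd ` set p = loop_nodes p"
proof -
  obtain u where u: "awalk u p u" "p \<noteq> []"
    using assms by (auto simp: cycle_def)
  have "fst (hd p) = u" "snd (last p) = u"
    using u(1) awends_of_awalk[OF u(1)] awalk_verts_conv[of u p] awalk_verts_conv'[of u p u] u(2)
    by (auto simp: awalk_def hd_map)
  moreover have "map fst p @ [snd (last p)] = fst (hd p) # map snd p"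
    using u awalk_verts_conv[of u p] awalk_verts_conv'[of u p u] by (auto simp: awalk_def)
  ultimately have "set (map fst p @ [u]) = set (u # map snd p)"
    by simp
  moreover have "u \<in> fst ` set p" "u \<in> snd ` set p"
    using \<open>fst (hd p) = u\<close> \<open>snd (last p) = u\<close> hd_in_set[OF u(2)] last_in_set[OF u(2)]
    by (metis imageI)+
  ultimately show ?thesis
    by (auto simp: loop_nodes_def insert_absorb)
qed

text \<open>The definition of \<open>cycle\<close> makes the heads distinct. The tails form the same
  set in a list of the same length, so counting makes them distinct too.\<close>

lemma cycle_unique_successor:
  assumes "cycle p" "(j, i) \<in> set p" "(j, i') \<in> set p"
  shows "i = i'"
proof -
  obtain u where u: "awalk u p u" "distinct (tl (pawalk_verts u p))" "p \<noteq> []"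
    using assms by (auto simp: cycle_def)
  then have "distinct (map snd p)"
    using awalk_verts_conv'[of u p u] by (auto simp: awalk_def)
  then have "card (fst ` set p) = length p"
    using cycle_heads[OF assms(1)] distinct_card[of "map snd p"] by (simp add: loop_nodes_def)
  then have "distinct (map fst p)"
    by (intro card_distinct) simp
  then show ?thesis
    using assms(2,3) by (simp add: distinct_map eq_key_imp_eq_value)
qed

text \<open>Shortening the walk back from \<open>i\<close> to \<open>j\<close> to a path removes
  repeated nodes, and the arc then closes it to a cycle.\<close>

lemma arc_on_cycle:
  assumes "(j, i) \<in> parcs G" "(i, j) \<in> (parcs G)\<^sup>*"
  shows "\<exists>p. cycle p \<and> (j, i) \<in> set p"
proof -
  have "\<exists>q. awalk i q j"
    using assms(2)
  proof (induction rule: converse_rtrancl_induct)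
    case base
    then show ?case
      using assms(1) by (auto simp: awalk_Nil_iff intro!: exI[of _ "[]"] dest: in_arcsD1)
  next
    case (step y z)
    then obtain q where "awalk z q j"
      by auto
    then have "awalk y ((y, z) # q) j"
      using step(1) by (auto simp: awalk_Cons_iff dest: in_arcsD1)
    then show ?case
      by blast
  qed
  then obtain q where "apath i q j"
    using reachable_apath reachable_awalk by blast
  then have "awalk j ((j, i) # q) j" "distinct (pawalk_verts i q)"
    using assms(1) by (auto simp: apath_def awalk_Cons_iff dest: in_arcsD1)
  then have "cycle ((j, i) # q)"
    unfolding cycle_def by (intro exI[of _ j]) auto
  then show ?thesis
    by (intro exI[of _ "(j, i) # q"]) auto
qed

end

lemma measured_row_eq:
  fixes C :: "transfer_fun^'n::finite^'p::finite" and T G :: "transfer_fun^'n^'n"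
  assumes "measurement_matrix C" "c \<in> measured_nodes C" "C ** T ** (mat 1 - G) = C"
  shows "T $ c $ j = (if j = c then 1 else 0) + (\<Sum>i\<in>UNIV. T $ c $ i * G $ i $ j)"
proof -
  obtain k where "C $ k $ c = 1"
    using assms(2) by (auto simp: measured_nodes_def)
  moreover obtain l where "\<And>i. C $ k $ i = (if i = l then 1 else 0)"
    using assms(1) unfolding measurement_matrix_def by blast
  \<comment> \<open>Row \<open>k\<close> of \<open>C\<close> is the unit vector of \<open>c\<close>,
    so row \<open>k\<close> of the matrix equation only involves row \<open>c\<close> of
    \<open>T\<close>.\<close>
  ultimately have k: "C $ k $ i = (if i = c then 1 else 0)" for i
    by (metis zero_neq_one)
  have row: "(C ** T) $ k $ i = T $ c $ i" for i
    by (simp add: matrix_matrix_mult_def k if_distrib[of "\<lambda>x. x * _"] cong: if_cong)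
  have "(C ** T ** (mat 1 - G)) $ k $ j = (\<Sum>i\<in>UNIV. T $ c $ i * (mat 1 - G) $ i $ j)"
    by (subst matrix_matrix_mult_def) (simp add: row)
  also have "\<dots> = T $ c $ j - (\<Sum>i\<in>UNIV. T $ c $ i * G $ i $ j)"
    by (simp add: right_diff_distrib sum_subtractf mat_def if_distrib[of "\<lambda>x. _ * x"] cong: if_cong)
  finally show ?thesis
    using k[of j] assms(3) by (simp add: algebra_simps)
qed

theorem mainTheorem6:
  fixes N :: "'n::finite pair_pre_digraph"
    and G0 :: "transfer_fun^'n^'n"
    and C :: "transfer_fun^'n^'p::finite"
    and I :: "'n set"
    and p :: "('n \<times> 'n) list"
  assumes "network_topology N"
    and "network_matrix G0"
    and "consistent N G0"
    and "well_posed G0"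
    and "measurement_matrix C"
    and "pre_digraph.cycle (with_proj N) p"
    and "I = loop_nodes p"
    and "\<And>p'. pre_digraph.cycle (with_proj N) p' \<Longrightarrow> loop_nodes p' \<inter> I \<noteq> {} \<Longrightarrow> same_loop p p'"
    and "\<And>i j. (j, i) \<in> set p \<Longrightarrow> G0 $ i $ j \<noteq> 0"
    and "measured_nodes C \<inter> I \<noteq> {}"
  shows "\<forall>(j, i) \<in> set p. identifiable N G0 C i j"
proof -
  interpret pair_digraph N
    using assms(1) by (simp add: network_topology_def)
  obtain c where c: "c \<in> measured_nodes C" "c \<in> loop_nodes p"
    using assms(7,10) by auto
  define t where "t = closed_loop G0 $ c"
  have arcs: "set p \<subseteq> parcs N"
    using assms(6) by (auto simp: cycle_def awalk_def)
  have inv: "invertible (mat 1 - G0)"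
    using assms(4) by (simp add: well_posed_def)

  have off_loop: "t $ i = 0" if ji: "(j, i) \<in> parcs N" "j \<in> loop_nodes p" "(j, i) \<notin> set p" for i j
  proof (rule ccontr)
    assume "t $ i \<noteq> 0"
    then have "(i, c) \<in> (parcs N)\<^sup>*"
      using closed_loop_eq_0_if_unreachable[OF inv assms(3)] by (auto simp: t_def)
    also have "(c, j) \<in> (parcs N)\<^sup>*"
      using cycle_rtrancl[OF assms(6) c(2) ji(2)] rtrancl_mono[OF arcs] by blast
    finally have "(i, j) \<in> (parcs N)\<^sup>*" .
    then obtain p' where p': "cycle p'" "(j, i) \<in> set p'"
      using arc_on_cycle[OF ji(1)] by blast
    moreover have "j \<in> loop_nodes p'"
      unfolding loop_nodes_def using p'(2) by force
    ultimately have "same_loop p p'"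
      using assms(7,8) ji(2) by blast
    \<comment> \<open>Rotating a list keeps its set of arcs.\<close>
    then show False
      using p'(2) ji(3) by (auto simp: same_loop_def)
  qed

  have loop_eq: "t $ j = (if j = c then 1 else 0) + t $ s * G $ s $ j"
    if G: "consistent N G" "C ** closed_loop G0 ** (mat 1 - G) = C" and js: "(j, s) \<in> set p"
    for G :: "transfer_fun^'n^'n" and j s
  proof -
    have "j \<in> loop_nodes p"
      unfolding loop_nodes_def using js by force
    \<comment> \<open>If \<open>(j, i)\<close> is not an arc, the entry of \<open>G\<close>
      vanishes; if it is an arc off the loop, \<open>t $ i\<close> does; on the loop,
      \<open>i\<close> would be \<open>s\<close>.\<close>
    then have "t $ i * G $ i $ j = 0" if "i \<noteq> s" for i
      using off_loop[of j i] cycle_unique_successor[OF assms(6) js] that G(1)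
      by (auto simp: consistent_def)
    then have "(\<Sum>i\<in>UNIV. t $ i * G $ i $ j) = (\<Sum>i\<in>UNIV. if i = s then t $ s * G $ s $ j else 0)"
      by (intro sum.cong) auto
    then show ?thesis
      using measured_row_eq[OF assms(5) c(1) G(2), of j] by (simp add: t_def)
  qed

  have "C ** closed_loop G0 ** (mat 1 - G0) = C"
    by (simp add: closed_loop_def matrix_inv_mult_left[OF inv] flip: matrix_mul_assoc)
  note loop_eq0 = loop_eq[OF assms(3) this]
  \<comment> \<open>Away from \<open>c\<close> the equation is
    \<open>t $ j = t $ s * G0 $ s $ j\<close> with a nonzero factor, so vanishing passes along each
    arc in both directions until \<open>c\<close> is reached.\<close>
  have zero_iff: "t $ j = 0 \<longleftrightarrow> t $ c = 0" if "j \<in> loop_nodes p" for j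
    using cycle_rtrancl[OF assms(6) that c(2)]
  proof (induction rule: converse_rtrancl_induct)
    case (step j s)
    then show ?case
      using loop_eq0[OF step(1)] assms(9)[OF step(1)] by (cases "j = c") auto
  qed simp
  have "t $ c \<noteq> 0"
  proof
    assume "t $ c = 0"
    \<comment> \<open>If \<open>t $ c\<close> vanished, so would \<open>t $ s\<close>, and the
      equation at \<open>c\<close> would read \<open>0 = 1\<close>.\<close>
    obtain s where s: "(c, s) \<in> set p"
      using c(2) by (auto simp: loop_nodes_def)
    then have "s \<in> loop_nodes p"
      using cycle_heads[OF assms(6)] by force
    with \<open>t $ c = 0\<close> show False
      using loop_eq0[OF s] zero_iff by simp
  qed

  show ?thesis
  proof (clarify, unfold identifiable_def, intro allI impI)
    fix j i and G :: "transfer_fun^'n^'n"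
    assume ji: "(j, i) \<in> set p"
      and G: "consistent N G \<and> C ** closed_loop G0 ** (mat 1 - G) = C"
    have "i \<in> loop_nodes p"
      using ji cycle_heads[OF assms(6)] by force
    then have "t $ i \<noteq> 0"
      using zero_iff \<open>t $ c \<noteq> 0\<close> by simp
    moreover have "t $ i * G $ i $ j = t $ i * G0 $ i $ j"
      using loop_eq[of G, OF _ _ ji] G loop_eq0[OF ji] by auto
    ultimately show "G $ i $ j = G0 $ i $ j"
      by simp
  qed
qed

end
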